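(* Let the capacity $c\in\mathbb{N}\cup\{\infty\}$ of the server be arbitrary but fixed and let $2\le\Theta\le\frac12(1+\sqrt{13})$. For every sufficiently small $\varepsilon>0$, there is a set of requests $\sigma$ (an instance of open, non-preemptive online Dial-a-Ride on the line) such that $\textsc{Smartstart}_\Theta$ starts its final schedule $S_N$ immediately after $S_{N-1}$ and such that $$\frac{\textsc{Smartstart}(\sigma)}{\textsc{Opt}(\sigma)}\ge\Theta+1-\frac{\Theta-1}{3\Theta+3}-\varepsilon .$$
   Context: Open, non-preemptive Dial-a-Ride on the real line. An instance is a finite nonempty set of requests $\sigma=\{\sigma_1,\dots,\sigma_n\}$ with $\sigma_i=(a_i,b_i;r_i)$, $a_i,b_i\in\mathbb{R}$, $r_i\ge 0$: request $\sigma_i$ appears at time $r_i$ at position $a_i$ and must be transported to position $b_i$. A single server of capacity $c\in\mathbb{N}\cup\{\infty\}$ starts at the origin at time $0$, moves with unit speed (it may also wait), cannot pick up a request before its release time, never carries more than $c$ requests at once, and a request that was picked up stays on board until it is delivered at its destination (non-preemptive). In the open version the server need not return to the origin. The length of a schedule is the time from its start until its last request is delivered (waiting included). $L(t,p,R)$ is the length of a shortest schedule that starts at position $p$ at time $t$ and serves all requests in $R\subseteq\sigma$ respecting release times. The offline optimum is $\textsc{Opt}(\sigma):=L(0,0,\sigma)$. In the online problem, $\sigma_i$ is revealed only at time $r_i$, and the number of requests is not known in advance. Algorithm $\textsc{Smartstart}_\Theta$ (parameter $\Theta>1$): let $R_t$ be the set of requests with release time at most $t$ that have not been served by time $t$.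 Starting at position $p_1=0$ at time $0$, for $j=1,2,\dots$: whenever the server is idle at position $p_j$ at current time $t$, it waits until there are unserved released requests and then until the earliest time $t_j:=\min\{t'\ge t: R_{t'}\ne\emptyset,\ t'\ge L(t',p_j,R_{t'})/(\Theta-1)\}$. At time $t_j$ it starts a shortest schedule $S_j$ serving $\sigma_{S_j}:=R_{t_j}$ from $p_j$, and executes it while ignoring all newly appearing requests; it ends at position $p_{j+1}$, the position where the last request of $S_j$ is delivered. $N$ denotes the number of schedules needed to serve $\sigma$, and $\textsc{Smartstart}(\sigma)=t_N+L(t_N,p_N,\sigma_{S_N})$ is the time at which all requests have been served. $\textsc{Smartstart}$ starts $S_N$ immediately after $S_{N-1}$ if $t_N=t_{N-1}+L(t_{N-1},p_{N-1},\sigma_{S_{N-1}})$, i.e. $t_N$ equals the finishing time of $S_{N-1}$. *)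

theory Defs
  imports "HOL-Analysis.Analysis" "HOL-Library.Extended_Nat"
begin

section \<open>Open, non-preemptive Dial-a-Ride on the real line\<close>

text \<open>A request appears at time \<open>rel\<close> at position \<open>src\<close> and must be transported to \<open>dst\<close>.\<close>

datatype request = Request (src: real) (dst: real) (rel: real)

definition dial_a_ride_instance :: "request set \<Rightarrow> bool" where
  "dial_a_ride_instance \<sigma> \<longleftrightarrow> finite \<sigma> \<and> \<sigma> \<noteq> {} \<and> (\<forall>r\<in>\<sigma>. rel r \<ge> 0)"

text \<open>A schedule is the trajectory of the server together with the times at which each
  request is picked up and delivered.  Only the values on the served requests and from the
  starting time onwards matter.  Since there is one pickup and one delivery time per request,
  schedules are non-preemptive.\<close>

record schedule =
  traj :: "real \<Rightarrow> real"
  pickup :: "request \<Rightarrow> real"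
  delivery :: "request \<Rightarrow> real"

text \<open>A request occupies one unit of capacity from pickup to delivery.  When several events
  happen at the same time, deliveries may precede pickups, so the load right after all events
  at time \<open>\<tau>\<close> is the number of requests with \<open>pickup \<le> \<tau> < delivery\<close>.  This count misses requests
  with \<open>src = dst\<close> that are picked up and delivered at the same instant; the second
  condition says that such a request also needs a free unit of capacity.\<close>

definition respects_capacity :: "enat \<Rightarrow> request set \<Rightarrow> schedule \<Rightarrow> bool" where
  "respects_capacity c R S \<longleftrightarrow>
     (\<forall>\<tau>. enat (card {q\<in>R. pickup S q \<le> \<tau> \<and> \<tau> < delivery S q}) \<le> c) \<and>
     (\<forall>r\<in>R. pickup S r = delivery S r \<longrightarrow>
        enat (card (insert r {q\<in>R. pickup S q < pickup S r \<and> pickup S r < delivery S q})) \<le> c)"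

text \<open>Moving with at most unit speed, possibly waiting, is being 1-Lipschitz.\<close>

definition feasible_schedule ::
    "enat \<Rightarrow> real \<Rightarrow> real \<Rightarrow> request set \<Rightarrow> schedule \<Rightarrow> bool" where
  "feasible_schedule c t p R S \<longleftrightarrow>
     1-lipschitz_on {t..} (traj S) \<and>
     traj S t = p \<and>
     (\<forall>r\<in>R. t \<le> pickup S r \<and> rel r \<le> pickup S r \<and> pickup S r \<le> delivery S r \<and>
        traj S (pickup S r) = src r \<and> traj S (delivery S r) = dst r) \<and>
     respects_capacity c R S"

text \<open>The time from the start \<open>t\<close> until the last delivery (0 if there are no requests).\<close>

definition schedule_length :: "real \<Rightarrow> request set \<Rightarrow> schedule \<Rightarrow> real" where
  "schedule_length t R S = Max (insert t (delivery S ` R)) - t"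

definition shortest_schedule ::
    "enat \<Rightarrow> real \<Rightarrow> real \<Rightarrow> request set \<Rightarrow> schedule \<Rightarrow> bool" where
  "shortest_schedule c t p R S \<longleftrightarrow>
     feasible_schedule c t p R S \<and>
     (\<forall>S'. feasible_schedule c t p R S' \<longrightarrow> schedule_length t R S \<le> schedule_length t R S')"

definition shortest_length :: "enat \<Rightarrow> real \<Rightarrow> real \<Rightarrow> request set \<Rightarrow> real" where
  "shortest_length c t p R = (INF S\<in>{S. feasible_schedule c t p R S}. schedule_length t R S)"

definition Opt :: "enat \<Rightarrow> request set \<Rightarrow> real" where
  "Opt c \<sigma> = shortest_length c 0 0 \<sigma>"


section \<open>The algorithm Smartstart\<close>

text \<open>The record of an execution: for \<open>j = 1, \<dots>, nscheds\<close>, schedule \<open>sched j\<close> starts at time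
  \<open>start j\<close> in position \<open>loc j\<close> and serves the requests \<open>batch j\<close>.  Values at other indices
  are irrelevant.\<close>

record run =
  nscheds :: nat
  start :: "nat \<Rightarrow> real"
  loc :: "nat \<Rightarrow> real"
  batch :: "nat \<Rightarrow> request set"
  sched :: "nat \<Rightarrow> schedule"

definition finish :: "enat \<Rightarrow> run \<Rightarrow> nat \<Rightarrow> real" where
  "finish c \<rho> j = start \<rho> j + shortest_length c (start \<rho> j) (loc \<rho> j) (batch \<rho> j)"

text \<open>The time from which on the server is idle and deciding when to start schedule \<open>j\<close>.\<close>

definition idle_from :: "enat \<Rightarrow> run \<Rightarrow> nat \<Rightarrow> real" where
  "idle_from c \<rho> j = (if j = 1 then 0 else finish c \<rho> (j - 1))"

text \<open>The requests released by time \<open>\<tau>\<close> that schedules \<open>1, \<dots>, j - 1\<close> have not served by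
  time \<open>\<tau>\<close>.\<close>

definition unserved :: "request set \<Rightarrow> run \<Rightarrow> nat \<Rightarrow> real \<Rightarrow> request set" where
  "unserved \<sigma> \<rho> j \<tau> =
     {r\<in>\<sigma>. rel r \<le> \<tau> \<and> \<not> (\<exists>i\<in>{1..<j}. r \<in> batch \<rho> i \<and> delivery (sched \<rho> i) r \<le> \<tau>)}"

definition may_start :: "enat \<Rightarrow> real \<Rightarrow> request set \<Rightarrow> run \<Rightarrow> nat \<Rightarrow> real \<Rightarrow> bool" where
  "may_start c \<Theta> \<sigma> \<rho> j \<tau> \<longleftrightarrow>
     idle_from c \<rho> j \<le> \<tau> \<and> unserved \<sigma> \<rho> j \<tau> \<noteq> {} \<and>
     shortest_length c \<tau> (loc \<rho> j) (unserved \<sigma> \<rho> j \<tau>) / (\<Theta> - 1) \<le> \<tau>"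

text \<open>The algorithm may follow any shortest schedule, so an instance may admit several runs.\<close>

definition smartstart_run :: "enat \<Rightarrow> real \<Rightarrow> request set \<Rightarrow> run \<Rightarrow> bool" where
  "smartstart_run c \<Theta> \<sigma> \<rho> \<longleftrightarrow>
     nscheds \<rho> \<ge> 1 \<and>
     loc \<rho> 1 = 0 \<and>
     (\<forall>j\<in>{1..nscheds \<rho>}.
        may_start c \<Theta> \<sigma> \<rho> j (start \<rho> j) \<and>
        (\<forall>\<tau>. may_start c \<Theta> \<sigma> \<rho> j \<tau> \<longrightarrow> start \<rho> j \<le> \<tau>) \<and>
        batch \<rho> j = unserved \<sigma> \<rho> j (start \<rho> j) \<and>
        shortest_schedule c (start \<rho> j) (loc \<rho> j) (batch \<rho> j) (sched \<rho> j)) \<and>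
     (\<forall>j\<in>{1..<nscheds \<rho>}. loc \<rho> (Suc j) = traj (sched \<rho> j) (finish c \<rho> j)) \<and>
     (\<Union>j\<in>{1..nscheds \<rho>}. batch \<rho> j) = \<sigma>"

definition smartstart_cost :: "enat \<Rightarrow> run \<Rightarrow> real" where
  "smartstart_cost c \<rho> = finish c \<rho> (nscheds \<rho>)"

definition final_starts_immediately :: "enat \<Rightarrow> run \<Rightarrow> bool" where
  "final_starts_immediately c \<rho> \<longleftrightarrow>
     nscheds \<rho> \<ge> 2 \<and> start \<rho> (nscheds \<rho>) = finish c \<rho> (nscheds \<rho> - 1)"

end

theory Submission
  imports Defs
begin

text \<open>
  Write \<open>L\<close> for the length of a shortest schedule.  A chain of requests released at the times
  \<open>\<delta> \<Theta>\<^sup>j\<close>, each as far to the right as the server accepts at once, drives the server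
  rightwards from time \<open>\<delta>\<close> on almost without rest: it starts the last of these schedules at
  time \<open>1\<close> and ends it at time \<open>\<Theta>\<close> in position \<open>\<Theta> - \<delta>\<close>.  Just after time \<open>1\<close>, when
  the server can no longer react, a request \<open>left\<close> appears near \<open>-1\<close> and a request \<open>right\<close>
  near \<open>2\<Theta> + 1\<close>, placed such that the server prefers by a hair to serve \<open>right\<close> first.  It
  waits until \<open>T = L/(\<Theta> - 1)\<close>, approximately \<open>(3\<Theta> + 3)/(\<Theta> - 1)\<close>, and returns to
  \<open>left\<close> at time \<open>\<Theta> T\<close>.  Meanwhile the optimum goes to \<open>left\<close> directly and then sweeps to
  the right, reaching position \<open>T - 2\<close> around time \<open>T\<close>, where the last request appears as soon as
  the server has committed itself.  The server needs about \<open>T - 1\<close> more, and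
  \<open>(\<Theta> T + T - 1)/T\<close> is the claimed ratio.
\<close>

section \<open>Schedules for requests without transport\<close>

lemma feasible_schedule_dist:
  assumes "feasible_schedule c t p R S" "t \<le> \<tau>" "\<tau> \<le> \<tau>'"
  shows "\<bar>traj S \<tau>' - traj S \<tau>\<bar> \<le> \<tau>' - \<tau>"
proof -
  have "1-lipschitz_on {t..} (traj S)"
    using assms(1) by (simp add: feasible_schedule_def)
  from lipschitz_onD[OF this, of \<tau>' \<tau>] assms show ?thesis
    by (simp add: dist_real_def)
qed

lemma feasible_schedule_delivery:
  assumes "feasible_schedule c t p R S" "r \<in> R"
  shows "t \<le> delivery S r" "rel r \<le> delivery S r" "traj S (delivery S r) = dst r"
  using assms by (auto simp: feasible_schedule_def intro: order_trans)

lemma feasible_schedule_delivery_ge: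
  assumes "feasible_schedule c t p R S" "r \<in> R"
  shows "t + \<bar>dst r - p\<bar> \<le> delivery S r"
proof -
  have "traj S t = p"
    using assms(1) by (simp add: feasible_schedule_def)
  then show ?thesis
    using feasible_schedule_dist[OF assms(1), of t "delivery S r"]
      feasible_schedule_delivery[OF assms] by simp
qed

lemma delivery_le_schedule_length:
  assumes "finite R" "r \<in> R"
  shows "delivery S r \<le> t + schedule_length t R S"
  using Max_ge[of "insert t (delivery S ` R)" "delivery S r"] assms
  by (simp add: schedule_length_def)

lemma schedule_length_le:
  assumes "finite R" "0 \<le> l" "\<And>r. r \<in> R \<Longrightarrow> delivery S r \<le> t + l"
  shows "schedule_length t R S \<le> l"
  using assms by (auto simp: schedule_length_def Max_le_iff algebra_simps)

text \<open>Pickup and delivery coincide, so nothing is ever on board for a positive time: the load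
  vanishes and a single unit of capacity suffices.\<close>

lemma feasible_point_schedule:
  assumes "c \<ge> 1" "1-lipschitz_on {t..} f" "f t = p"
    and "\<And>r. r \<in> R \<Longrightarrow> t \<le> d r \<and> rel r \<le> d r \<and> f (d r) = src r \<and> src r = dst r"
  shows "feasible_schedule c t p R \<lparr>traj = f, pickup = d, delivery = d\<rparr>"
proof -
  have no_load: "{q \<in> R. d q \<le> \<tau> \<and> \<tau> < d q} = {}" "{q \<in> R. d q < \<tau> \<and> \<tau> < d q} = {}" for \<tau>
    by auto
  have "enat 1 \<le> c"
    using assms(1) by (simp add: one_enat_def)
  then show ?thesis
    using assms by (fastforce simp: feasible_schedule_def respects_capacity_def no_load zero_enat_def[symmetric])
qed

text \<open>A feasible schedule that meets a lower bound turns the infimum into a minimum. Every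
  length below, the optimum included, is computed from such a pair.\<close>

lemma shortest_scheduleI:
  assumes "feasible_schedule c t p R S\<^sub>0" "schedule_length t R S\<^sub>0 \<le> l"
    and "\<And>S. feasible_schedule c t p R S \<Longrightarrow> l \<le> schedule_length t R S"
  shows "shortest_schedule c t p R S\<^sub>0" "shortest_length c t p R = l"
proof -
  have len: "schedule_length t R S\<^sub>0 = l"
    using assms by (meson order_antisym)
  then show "shortest_schedule c t p R S\<^sub>0"
    using assms by (simp add: shortest_schedule_def)
  show "shortest_length c t p R = l"
    unfolding shortest_length_def
    by (rule cInf_eq_minimum) (use assms len in auto)
qed

lemma shortest_schedule_length:
  assumes "shortest_schedule c t p R S"
  shows "schedule_length t R S = shortest_length c t p R"
  using shortest_scheduleI(2)[of c t p R S "schedule_length t R S"] assms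
  by (auto simp: shortest_schedule_def)

lemma shortest_schedule_delivery_le:
  assumes "shortest_schedule c t p R S" "finite R" "r \<in> R"
  shows "delivery S r \<le> t + shortest_length c t p R"
  using delivery_le_schedule_length[OF assms(2,3)] shortest_schedule_length[OF assms(1)] by metis

text \<open>The third claim covers all shortest schedules, because the algorithm may choose any of
  them and its next position must be known.\<close>

lemma shortest_schedule_singleton:
  assumes "c \<ge> 1" "rel r \<le> t" "src r = dst r"
  shows "\<exists>S. shortest_schedule c t p {r} S"
    and "shortest_length c t p {r} = \<bar>dst r - p\<bar>"
    and "shortest_schedule c t p {r} S \<Longrightarrow> traj S (t + \<bar>dst r - p\<bar>) = dst r"
proof -
  \<comment> \<open>The trajectory runs on past the target, which is harmless since only its values
    at service times matter; \<open>sgn\<close> makes it rest if the server is already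
    there.\<close>
  define f where "f \<tau> = p + sgn (dst r - p) * (\<tau> - t)" for \<tau>
  define S\<^sub>0 where "S\<^sub>0 = \<lparr>traj = f, pickup = \<lambda>_. t + \<bar>dst r - p\<bar>, delivery = \<lambda>_. t + \<bar>dst r - p\<bar>\<rparr>"
  have "1-lipschitz_on {t..} f"
    by (rule lipschitz_onI) (auto simp: f_def dist_real_def sgn_if)
  moreover have "f (t + \<bar>dst r - p\<bar>) = src r"
    using assms by (auto simp: f_def sgn_if abs_if)
  ultimately have feas: "feasible_schedule c t p {r} S\<^sub>0"
    unfolding S\<^sub>0_def using assms by (intro feasible_point_schedule) (auto simp: f_def)
  have len: "schedule_length t {r} S\<^sub>0 \<le> \<bar>dst r - p\<bar>"
    by (rule schedule_length_le) (auto simp: S\<^sub>0_def)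
  have low: "\<bar>dst r - p\<bar> \<le> schedule_length t {r} S" if "feasible_schedule c t p {r} S" for S
    using feasible_schedule_delivery_ge[OF that, of r] delivery_le_schedule_length[of "{r}" r S t]
    by simp
  show "\<exists>S. shortest_schedule c t p {r} S"
    using shortest_scheduleI(1)[OF feas len low] by blast
  show sl: "shortest_length c t p {r} = \<bar>dst r - p\<bar>"
    by (rule shortest_scheduleI(2)[OF feas len low])
  assume S: "shortest_schedule c t p {r} S"
  then have "feasible_schedule c t p {r} S"
    by (simp add: shortest_schedule_def)
  moreover from this have "delivery S r = t + \<bar>dst r - p\<bar>"
    using feasible_schedule_delivery_ge[of c t p "{r}" S r] shortest_schedule_delivery_le[OF S, of r] sl
    by simp
  ultimately show "traj S (t + \<bar>dst r - p\<bar>) = dst r"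
    using feasible_schedule_delivery(3)[of c t p "{r}" S r] by simp
qed

text \<open>Since the server is closer to \<open>v\<close>, serving \<open>v\<close> first is strictly faster, so every
  shortest schedule ends at \<open>u\<close>.\<close>

lemma shortest_schedule_pair:
  assumes "c \<ge> 1" "rel u \<le> t" "rel v \<le> t" "src u = dst u" "src v = dst v"
    and pos: "dst u \<le> p" "p \<le> dst v" "dst v - p < p - dst u"
  shows "\<exists>S. shortest_schedule c t p {u, v} S"
    and "shortest_length c t p {u, v} = 2 * dst v - p - dst u"
    and "shortest_schedule c t p {u, v} S \<Longrightarrow> traj S (t + (2 * dst v - p - dst u)) = dst u"
proof -
  let ?l = "2 * dst v - p - dst u"
  \<comment> \<open>A tent: rightwards to the peak \<open>dst v\<close> at time
    \<open>t + dst v - p\<close>, then leftwards through \<open>dst u\<close>.\<close>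
  define f where "f \<tau> = dst v - \<bar>\<tau> - (t + dst v - p)\<bar>" for \<tau>
  define d where "d r = (if r = u then t + ?l else t + dst v - p)" for r
  define S\<^sub>0 where "S\<^sub>0 = \<lparr>traj = f, pickup = d, delivery = d\<rparr>"
  have "1-lipschitz_on {t..} f"
    by (rule lipschitz_onI) (auto simp: f_def dist_real_def)
  then have feas: "feasible_schedule c t p {u, v} S\<^sub>0"
    unfolding S\<^sub>0_def using assms
    by (intro feasible_point_schedule) (auto simp: f_def d_def)
  have len: "schedule_length t {u, v} S\<^sub>0 \<le> ?l"
    by (rule schedule_length_le) (use pos in \<open>auto simp: S\<^sub>0_def d_def\<close>)
  \<comment> \<open>Serving \<open>u\<close> first costs at least
    \<open>p - 2 * dst u + dst v\<close>, which by \<open>pos\<close> strictly exceeds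
    \<open>?l\<close>. Hence equality forces \<open>u\<close> to be last, at exactly
    \<open>t + ?l\<close>.\<close>
  have low: "?l \<le> schedule_length t {u, v} S \<and>
      (schedule_length t {u, v} S = ?l \<longrightarrow> delivery S u = t + ?l)"
    if S: "feasible_schedule c t p {u, v} S" for S
  proof -
    note del = feasible_schedule_delivery[OF S, of u] feasible_schedule_delivery[OF S, of v]
      feasible_schedule_delivery_ge[OF S, of u] feasible_schedule_delivery_ge[OF S, of v]
      delivery_le_schedule_length[of "{u, v}" u S t] delivery_le_schedule_length[of "{u, v}" v S t]
    show ?thesis
    proof (cases "delivery S v \<le> delivery S u")
      case True
      then have "\<bar>dst u - dst v\<bar> \<le> delivery S u - delivery S v"
        using feasible_schedule_dist[OF S _ True] del by simp
      then show ?thesis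
        using del pos by simp
    next
      case False
      then have "\<bar>dst v - dst u\<bar> \<le> delivery S v - delivery S u"
        using feasible_schedule_dist[OF S, of "delivery S u" "delivery S v"] del by simp
      then show ?thesis
        using del pos by simp
    qed
  qed
  show "\<exists>S. shortest_schedule c t p {u, v} S"
    using shortest_scheduleI(1)[OF feas len] low by blast
  show sl: "shortest_length c t p {u, v} = ?l"
    using shortest_scheduleI(2)[OF feas len] low by blast
  assume S: "shortest_schedule c t p {u, v} S"
  then have S': "feasible_schedule c t p {u, v} S"
    by (simp add: shortest_schedule_def)
  have "delivery S u = t + ?l"
    using low[OF S'] shortest_schedule_length[OF S] sl by simp
  then show "traj S (t + ?l) = dst u"
    using feasible_schedule_delivery(3)[OF S', of u] by simp
qed


section \<open>Instances with an essentially unique run\<close>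

text \<open>The assumptions mention no run, so they can be checked on a concrete instance, and they
  force the start times, positions and batches of every run. \<open>length_le\<close> is the
  starting condition with the division cleared, \<open>too_early\<close> its failure before
  \<open>st j\<close>; \<open>traj_fin\<close> handles the freedom among shortest schedules.\<close>

locale smartstart_script =
  fixes c :: enat and \<Theta> :: real and \<sigma> :: "request set" and N :: nat
    and st lc fin :: "nat \<Rightarrow> real" and bt :: "nat \<Rightarrow> request set"
  assumes theta: "\<Theta> > 1"
    and N: "N \<ge> 1"
    and fin_sigma: "finite \<sigma>"
    and lc1: "lc 1 = 0"
    and Union_bt: "(\<Union>j\<in>{1..N}. bt j) = \<sigma>"
    and bt_ne: "\<And>j. j \<in> {1..N} \<Longrightarrow> bt j \<noteq> {}"
    and bt_eq: "\<And>j. j \<in> {1..N} \<Longrightarrow> {r\<in>\<sigma>. rel r \<le> st j} - (\<Union>i\<in>{1..<j}. bt i) = bt j"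
    and idle_le: "\<And>j. j \<in> {1..N} \<Longrightarrow> (if j = 1 then 0 else fin (j - 1)) \<le> st j"
    and st_le: "\<And>j. j \<in> {1..N} \<Longrightarrow> st j \<le> fin j"
    and length_eq: "\<And>j. j \<in> {1..N} \<Longrightarrow> shortest_length c (st j) (lc j) (bt j) = fin j - st j"
    and length_le: "\<And>j. j \<in> {1..N} \<Longrightarrow> fin j \<le> \<Theta> * st j"
    and too_early: "\<And>j \<tau>. j \<in> {1..N} \<Longrightarrow> (if j = 1 then 0 else fin (j - 1)) \<le> \<tau> \<Longrightarrow> \<tau> < st j \<Longrightarrow>
      {r\<in>\<sigma>. rel r \<le> \<tau>} - (\<Union>i\<in>{1..<j}. bt i) \<noteq> {} \<Longrightarrow>
      (\<Theta> - 1) * \<tau> < shortest_length c \<tau> (lc j) ({r\<in>\<sigma>. rel r \<le> \<tau>} - (\<Union>i\<in>{1..<j}. bt i))"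
    and shortest_ex: "\<And>j. j \<in> {1..N} \<Longrightarrow> \<exists>S. shortest_schedule c (st j) (lc j) (bt j) S"
    and traj_fin: "\<And>j S. j \<in> {1..<N} \<Longrightarrow> shortest_schedule c (st j) (lc j) (bt j) S \<Longrightarrow>
      traj S (fin j) = lc (Suc j)"
begin

definition pending :: "nat \<Rightarrow> real \<Rightarrow> request set" where
  "pending j \<tau> = {r\<in>\<sigma>. rel r \<le> \<tau>} - (\<Union>i\<in>{1..<j}. bt i)"

definition idle :: "nat \<Rightarrow> real" where
  "idle j = (if j = 1 then 0 else fin (j - 1))"

text \<open>Only the choice among shortest schedules is left open, which is where runs may
  differ.\<close>

definition follows :: "run \<Rightarrow> nat \<Rightarrow> bool" where
  "follows \<rho> j \<longleftrightarrow> start \<rho> j = st j \<and> loc \<rho> j = lc j \<and> batch \<rho> j = bt j \<and>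
     shortest_schedule c (st j) (lc j) (bt j) (sched \<rho> j)"

lemma fin_le_idle:
  assumes "i \<in> {1..<j}" "j \<le> Suc N"
  shows "fin i \<le> idle j"
proof -
  from assms have "Suc i \<le> j" "1 \<le> i" by auto
  then have "j \<le> Suc N \<longrightarrow> fin i \<le> fin (j - 1)"
  proof (induction j rule: dec_induct)
    case (step n)
    then show ?case
      using idle_le[of n] st_le[of n] by auto
  qed simp
  then show ?thesis
    using assms by (auto simp: idle_def)
qed

lemma follows_finish: "follows \<rho> j \<Longrightarrow> j \<in> {1..N} \<Longrightarrow> finish c \<rho> j = fin j"
  by (simp add: follows_def finish_def length_eq)

lemma follows_idle_from:
  assumes "\<And>i. i \<in> {1..<j} \<Longrightarrow> follows \<rho> i" "1 \<le> j" "j \<le> Suc N"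
  shows "idle_from c \<rho> j = idle j"
  using assms(2,3) follows_finish[OF assms(1), of "j - 1"] by (auto simp: idle_from_def idle_def)

text \<open>All earlier schedules are over once the server is idle again, so the delivery times in
  \<open>unserved\<close> no longer matter and a plain set difference remains.\<close>

lemma follows_unserved:
  assumes fol: "\<And>i. i \<in> {1..<j} \<Longrightarrow> follows \<rho> i" and j: "j \<le> Suc N" and "idle j \<le> \<tau>"
  shows "unserved \<sigma> \<rho> j \<tau> = pending j \<tau>"
proof -
  have "delivery (sched \<rho> i) r \<le> \<tau> \<and> batch \<rho> i = bt i"
    if "i \<in> {1..<j}" "r \<in> batch \<rho> i" for i r
  proof -
    have "i \<in> {1..N}" using that j by auto
    moreover from this have "finite (bt i)"
      using fin_sigma Union_bt by (metis UN_upper finite_subset)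
    ultimately have "delivery (sched \<rho> i) r \<le> fin i"
      using fol[OF that(1)] that(2) length_eq[of i]
        shortest_schedule_delivery_le[of c "st i" "lc i" "bt i" "sched \<rho> i" r]
      by (simp add: follows_def)
    then show ?thesis
      using fin_le_idle[OF that(1) j] assms(3) fol[OF that(1)] by (auto simp: follows_def)
  qed
  moreover have "batch \<rho> i = bt i" if "i \<in> {1..<j}" for i
    using fol[OF that] by (simp add: follows_def)
  ultimately show ?thesis
    by (fastforce simp: unserved_def pending_def)
qed

lemma follows_may_start:
  assumes "\<And>i. i \<in> {1..<j} \<Longrightarrow> follows \<rho> i" "1 \<le> j" "j \<le> Suc N" "loc \<rho> j = lc j"
  shows "may_start c \<Theta> \<sigma> \<rho> j \<tau> \<longleftrightarrow>
    idle j \<le> \<tau> \<and> pending j \<tau> \<noteq> {} \<and> shortest_length c \<tau> (lc j) (pending j \<tau>) \<le> (\<Theta> - 1) * \<tau>"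
  using assms follows_unserved[of j \<rho> \<tau>] follows_idle_from[of j \<rho>] theta
  by (auto simp: may_start_def field_simps)

lemma pending_st: "j \<in> {1..N} \<Longrightarrow> pending j (st j) = bt j"
  using bt_eq by (simp add: pending_def)

lemma follows_least:
  assumes "\<And>i. i \<in> {1..<j} \<Longrightarrow> follows \<rho> i" "j \<in> {1..N}" "loc \<rho> j = lc j"
  shows "may_start c \<Theta> \<sigma> \<rho> j (st j)" "may_start c \<Theta> \<sigma> \<rho> j \<tau> \<Longrightarrow> st j \<le> \<tau>"
proof -
  have ms: "may_start c \<Theta> \<sigma> \<rho> j \<tau> \<longleftrightarrow> idle j \<le> \<tau> \<and> pending j \<tau> \<noteq> {} \<and>
      shortest_length c \<tau> (lc j) (pending j \<tau>) \<le> (\<Theta> - 1) * \<tau>" for \<tau>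
    using follows_may_start[of j \<rho> \<tau>] assms by auto
  show "may_start c \<Theta> \<sigma> \<rho> j (st j)"
    using assms(2) pending_st bt_ne idle_le[of j] length_eq[of j] length_le[of j]
    by (simp add: ms idle_def algebra_simps)
  show "may_start c \<Theta> \<sigma> \<rho> j \<tau> \<Longrightarrow> st j \<le> \<tau>"
    using too_early[OF assms(2), of \<tau>] unfolding ms idle_def pending_def by force
qed

text \<open>By strong induction: the earlier schedules fix the position, through
  \<open>traj_fin\<close>, and the pending set; the start time is then the unique least admissible
  one.\<close>

lemma run_follows:
  assumes run: "smartstart_run c \<Theta> \<sigma> \<rho>" and "j \<in> {1..nscheds \<rho>}" "j \<le> N"
  shows "follows \<rho> j"
  using assms(2,3)
proof (induction j rule: less_induct)
  case (less j)
  then have fol: "follows \<rho> i" if "i \<in> {1..<j}" for i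
    using that by auto
  have j: "j \<in> {1..N}" using less.prems by auto
  have loc: "loc \<rho> j = lc j"
  proof (cases "j = 1")
    case True
    then show ?thesis using run lc1 by (simp add: smartstart_run_def)
  next
    case False
    then obtain i where i: "j = Suc i" "i \<in> {1..<j}" using j by (cases j) auto
    have "loc \<rho> j = traj (sched \<rho> i) (finish c \<rho> i)"
      using run i less.prems by (auto simp: smartstart_run_def)
    then show ?thesis
      using fol[OF i(2)] follows_finish[OF fol[OF i(2)]] traj_fin[of i] i j by (auto simp: follows_def)
  qed
  note least = follows_least[OF fol j loc]
  have st: "start \<rho> j = st j"
    using least run less.prems(1) unfolding smartstart_run_def by (meson order_antisym)
  have "batch \<rho> j = unserved \<sigma> \<rho> j (st j)"
    using run less.prems st by (simp add: smartstart_run_def)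
  also have "\<dots> = bt j"
    using follows_unserved[OF fol, of j "st j"] idle_le[OF j] pending_st[OF j] j
    by (simp add: idle_def)
  finally have "batch \<rho> j = bt j" .
  moreover have "shortest_schedule c (start \<rho> j) (loc \<rho> j) (batch \<rho> j) (sched \<rho> j)"
    using run less.prems(1) unfolding smartstart_run_def by blast
  ultimately show ?case
    using st loc by (simp add: follows_def)
qed

text \<open>An extra schedule would find nothing pending and could never start. With fewer schedules
  the requests of \<open>bt N\<close>, which lie in no earlier batch, would stay unserved.\<close>

lemma run_nscheds:
  assumes run: "smartstart_run c \<Theta> \<sigma> \<rho>"
  shows "nscheds \<rho> = N"
proof (rule antisym)
  show "nscheds \<rho> \<le> N"
  proof (rule ccontr)
    assume "\<not> nscheds \<rho> \<le> N"
    then have N1: "Suc N \<in> {1..nscheds \<rho>}" by auto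
    then have fol: "follows \<rho> i" if "i \<in> {1..<Suc N}" for i
      using run_follows[OF run, of i] that by auto
    have "may_start c \<Theta> \<sigma> \<rho> (Suc N) (start \<rho> (Suc N))"
      using run N1 by (simp add: smartstart_run_def)
    then have "idle (Suc N) \<le> start \<rho> (Suc N)" "unserved \<sigma> \<rho> (Suc N) (start \<rho> (Suc N)) \<noteq> {}"
      using follows_idle_from[OF fol] by (auto simp: may_start_def)
    then show False
      using follows_unserved[OF fol, of "Suc N"] Union_bt
      by (auto simp: pending_def atLeastLessThanSuc_atLeastAtMost)
  qed
  show "N \<le> nscheds \<rho>"
  proof (rule ccontr)
    assume less: "\<not> N \<le> nscheds \<rho>"
    obtain r where r: "r \<in> bt N" using bt_ne[of N] N by auto
    then have "r \<in> \<sigma>" using Union_bt N by auto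
    then obtain i where i: "i \<in> {1..nscheds \<rho>}" "r \<in> batch \<rho> i"
      using run by (auto simp: smartstart_run_def)
    then have "r \<in> bt i" using run_follows[OF run, of i] less by (auto simp: follows_def)
    moreover have "i \<in> {1..<N}" using i less by auto
    ultimately show False
      using r bt_eq[of N] N by (metis (no_types, lifting) DiffE UN_I atLeastAtMost_iff order_refl)
  qed
qed

lemma run_cost:
  assumes run: "smartstart_run c \<Theta> \<sigma> \<rho>"
  shows "smartstart_cost c \<rho> = fin N"
  using run_nscheds[OF run] run_follows[OF run, of N] N follows_finish
  by (simp add: smartstart_cost_def)

lemma run_final_starts_immediately:
  assumes run: "smartstart_run c \<Theta> \<sigma> \<rho>" and "N \<ge> 2" "st N = fin (N - 1)"
  shows "final_starts_immediately c \<rho>"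
  using assms run_nscheds[OF run] run_follows[OF run, of N] run_follows[OF run, of "N - 1"]
    follows_finish[of \<rho> "N - 1"]
  by (simp add: final_starts_immediately_def follows_def)

text \<open>Without this, the claims about all runs could be vacuous.\<close>

lemma run_exists: "\<exists>\<rho>. smartstart_run c \<Theta> \<sigma> \<rho>"
proof -
  define \<rho> where "\<rho> = \<lparr>nscheds = N, start = st, loc = lc, batch = bt,
    sched = \<lambda>j. SOME S. shortest_schedule c (st j) (lc j) (bt j) S\<rparr>"
  have fol: "follows \<rho> j" if "j \<in> {1..N}" for j
    using someI_ex[OF shortest_ex[OF that]] by (simp add: \<rho>_def follows_def)
  then have fol_less: "follows \<rho> i" if "i \<in> {1..<j}" "j \<in> {1..N}" for i j
    using that by auto
  have "may_start c \<Theta> \<sigma> \<rho> j (start \<rho> j) \<and> (\<forall>\<tau>. may_start c \<Theta> \<sigma> \<rho> j \<tau> \<longrightarrow> start \<rho> j \<le> \<tau>) \<and>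
      batch \<rho> j = unserved \<sigma> \<rho> j (start \<rho> j) \<and>
      shortest_schedule c (start \<rho> j) (loc \<rho> j) (batch \<rho> j) (sched \<rho> j)"
    if j: "j \<in> {1..N}" for j
    using follows_least[OF fol_less[OF _ j] j] fol[OF j] idle_le[OF j] pending_st[OF j] j
      follows_unserved[OF fol_less[OF _ j], where \<tau> = "st j"]
    by (simp add: follows_def idle_def)
  moreover have "loc \<rho> (Suc j) = traj (sched \<rho> j) (finish c \<rho> j)" if "j \<in> {1..<N}" for j
    using traj_fin[OF that] follows_finish[OF fol, of j] fol[of j] fol[of "Suc j"] that
    by (simp add: follows_def)
  moreover have "nscheds \<rho> = N" "loc \<rho> 1 = 0" "(\<Union>j\<in>{1..N}. batch \<rho> j) = \<sigma>"
    using lc1 Union_bt by (auto simp: \<rho>_def)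
  ultimately show ?thesis
    using N unfolding smartstart_run_def by metis
qed

end


section \<open>The lower bound\<close>

abbreviation point_request :: "real \<Rightarrow> real \<Rightarrow> request" where
  "point_request a \<equiv> Request a a"

text \<open>\<open>theta_square\<close> is the upper bound on \<Theta> in polynomial form;
  \<open>n\<close> controls the length of the chain.\<close>

locale lower_bound =
  fixes c :: enat and \<Theta> :: real and n :: nat
  assumes c: "c \<ge> 1" and theta_ge: "2 \<le> \<Theta>" and theta_square: "\<Theta>\<^sup>2 \<le> \<Theta> + 3"
begin

text \<open>Normalised such that the last of the \<open>n + 1\<close> chain schedules starts at time
  1.\<close>

definition \<delta> :: real where "\<delta> = 1 / \<Theta> ^ n"
text \<open>The tour from \<open>\<Theta> - \<delta>\<close> to \<open>right\<close> and then to
  \<open>left\<close> has the numerator as its length, so this is the first time at which it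
  satisfies the starting condition.\<close>

definition T :: real where "T = (3 * \<Theta> + 3 - 2 * \<delta>) / (\<Theta> - 1)"
text \<open>The margin keeps \<open>final\<close> out of the batch of \<open>left\<close> and
  \<open>right\<close>, and its size compensates the \<open>2 * \<delta>\<close> subtracted in
  \<open>T\<close>.\<close>

definition T' :: real where "T' = T + 4 * \<delta>"

text \<open>At the release time the server stands at
  \<open>\<delta> * \<Theta> ^ (j - 1) - \<delta>\<close>. The request is
  \<open>\<Theta> - 1\<close> times the current time away, the farthest for which the server starts
  at once.\<close>

definition phase :: "nat \<Rightarrow> request" where
  "phase j = point_request (\<delta> * \<Theta> ^ j - \<delta>) (\<delta> * \<Theta> ^ (j - 1))"
text \<open>Both \<open>left\<close> and \<open>right\<close> appear just after the last chain
  schedule has started. From its end \<open>\<Theta> - \<delta>\<close> they are at distance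
  \<open>\<Theta> + 1\<close> and \<open>\<Theta> + 1 - \<delta>\<close>, so \<open>right\<close> is
  closer by \<delta>.\<close>

definition left :: request where
  "left = point_request (- 1 - \<delta>) (1 + \<delta>)"
definition right :: request where
  "right = point_request (2 * \<Theta> + 1 - 2 * \<delta>) (1 + \<delta>)"
text \<open>This is where a server that first visits \<open>left\<close> and then turns right
  arrives at time \<open>T'\<close>.\<close>

definition final :: request where
  "final = point_request (T' - 2 * (1 + \<delta>)) T'"

definition \<sigma> :: "request set" where
  "\<sigma> = phase ` {1..n + 1} \<union> {left, right, final}"

definition st :: "nat \<Rightarrow> real" where
  "st j = (if j \<le> n + 1 then \<delta> * \<Theta> ^ (j - 1) else if j = n + 2 then T else \<Theta> * T)"
definition lc :: "nat \<Rightarrow> real" where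
  "lc j = (if j \<le> n + 2 then \<delta> * \<Theta> ^ (j - 1) - \<delta> else - 1 - \<delta>)"
definition bt :: "nat \<Rightarrow> request set" where
  "bt j = (if j \<le> n + 1 then {phase j} else if j = n + 2 then {left, right} else {final})"
text \<open>Up to \<open>n + 2\<close> the starting condition holds with equality, hence the factor
  \<Theta>; the last value comes from the distance between \<open>left\<close> and
  \<open>final\<close>.\<close>

definition fin :: "nat \<Rightarrow> real" where
  "fin j = (if j \<le> n + 2 then \<Theta> * st j else \<Theta> * T + (T' - (1 + \<delta>)))"

section \<open>Estimates for the constants\<close>

lemma delta: "0 < \<delta>" "\<delta> \<le> 1" and delta_power: "\<delta> * \<Theta> ^ n = 1"
  using theta_ge by (auto simp: \<delta>_def)

lemma theta_le: "\<Theta> \<le> 3"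
proof (rule ccontr)
  assume "\<not> \<Theta> \<le> 3"
  then have "3 * \<Theta> \<le> \<Theta> * \<Theta>" by (intro mult_right_mono) auto
  with theta_square \<open>\<not> \<Theta> \<le> 3\<close> show False by (simp add: power2_eq_square)
qed

lemma T_mult: "(\<Theta> - 1) * T = 3 * \<Theta> + 3 - 2 * \<delta>"
  using theta_ge by (simp add: T_def)

text \<open>The second bound says that the chain ends no later than \<open>T\<close>; the first
  yields \<open>T' \<le> 2 * T\<close>, and so \<open>final\<close> appears before the pair schedule
  ends.\<close>

lemma le_T: "4 * \<delta> \<le> T" "\<Theta> \<le> T"
proof -
  have "(\<Theta> - 1) * (4 * \<delta>) \<le> (\<Theta> - 1) * 4"
    using delta theta_ge by (intro mult_left_mono) auto
  also have "\<dots> \<le> (\<Theta> - 1) * T"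
    unfolding T_mult using theta_le delta by simp
  finally show "4 * \<delta> \<le> T" using theta_ge by simp
  have "(\<Theta> - 1) * \<Theta> \<le> (\<Theta> - 1) * T"
    unfolding T_mult using theta_square theta_ge delta
    by (simp add: power2_eq_square left_diff_distrib)
  then show "\<Theta> \<le> T" using theta_ge by simp
qed

text \<open>In turn: \<open>final\<close> is unknown when the pair schedule starts, known when the
  server becomes idle at \<open>\<Theta> * T\<close>, and may then be served without
  waiting.\<close>

lemma T'_le: "T < T'" "T' \<le> \<Theta> * T" "\<Theta> * T + (T' - (1 + \<delta>)) \<le> \<Theta> * (\<Theta> * T)"
proof -
  have T: "2 \<le> T" using le_T theta_ge by linarith
  show "T < T'" using delta by (simp add: T'_def)
  have 1: "2 * T \<le> \<Theta> * T" using theta_ge T by (intro mult_right_mono) auto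
  then show "T' \<le> \<Theta> * T" using le_T by (simp add: T'_def)
  have "2 * (\<Theta> * T) \<le> \<Theta> * (\<Theta> * T)" using theta_ge 1 T by (intro mult_right_mono) auto
  then show "\<Theta> * T + (T' - (1 + \<delta>)) \<le> \<Theta> * (\<Theta> * T)"
    unfolding T'_def using 1 le_T T delta by linarith
qed

text \<open>The only place where the upper bound on \<open>\<Theta>\<close> is tight: on its final way to the right,
  the optimum passes \<open>right\<close>.\<close>

lemma right_le_final: "2 * \<Theta> + 1 - 2 * \<delta> \<le> T' - 2 * (1 + \<delta>)"
proof -
  have "\<delta> * 2 \<le> \<delta> * \<Theta>" using delta theta_ge by (intro mult_left_mono) auto
  moreover have "(\<Theta> - 1) * (2 * \<Theta> + 3 - 4 * \<delta>) = 2 * \<Theta>\<^sup>2 + \<Theta> - 3 - 4 * (\<delta> * \<Theta>) + 4 * \<delta>"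
    by (simp add: algebra_simps power2_eq_square)
  ultimately have "(\<Theta> - 1) * (2 * \<Theta> + 3 - 4 * \<delta>) \<le> (\<Theta> - 1) * T"
    unfolding T_mult using theta_square delta by linarith
  then show ?thesis using theta_ge by (simp add: T'_def)
qed

section \<open>Released and pending requests\<close>

lemma phase_eq_iff: "1 \<le> i \<Longrightarrow> 1 \<le> j \<Longrightarrow> phase i = phase j \<longleftrightarrow> i = j"
  using theta_ge delta by (auto simp: phase_def)

lemma power_le_1: "j \<le> n + 1 \<Longrightarrow> \<delta> * \<Theta> ^ (j - 1) \<le> 1"
  unfolding delta_power[symmetric] using theta_ge delta
  by (intro mult_left_mono power_increasing) auto

lemma rel_late: "r \<in> {left, right, final} \<Longrightarrow> 1 < rel r" and T'_gt: "1 + \<delta> < T'"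
  using T'_le(1) le_T(2) theta_ge delta by (auto simp: left_def right_def final_def)

lemma phase_disjoint: "phase ` {1..n + 1} \<inter> {left, right, final} = {}"
proof -
  have "phase j \<notin> {left, right, final}" if "j \<in> {1..n + 1}" for j
  proof
    assume "phase j \<in> {left, right, final}"
    then have "1 < rel (phase j)" by (rule rel_late)
    then show False using power_le_1[of j] that by (simp add: phase_def)
  qed
  then show ?thesis
    unfolding disjoint_iff by (metis imageE)
qed

lemma final_neq: "final \<noteq> left" "final \<noteq> right"
  using T'_gt by (simp_all add: final_def left_def right_def)

lemma released_phase:
  assumes "j \<in> {1..n + 1}"
  shows "{r\<in>\<sigma>. rel r \<le> st j} = phase ` {1..j}"
    and "\<tau> < st j \<Longrightarrow> {r\<in>\<sigma>. rel r \<le> \<tau>} \<subseteq> phase ` {1..<j}"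
proof -
  have late: "st j < rel r" if "r \<in> {left, right, final}" for r
    using rel_late[OF that] power_le_1[of j] assms by (simp add: st_def)
  have early: "rel (phase i) \<le> st j \<longleftrightarrow> i \<le> j" "rel (phase i) < st j \<longleftrightarrow> i < j" if "1 \<le> i" for i
    using that assms theta_ge delta by (auto simp: st_def phase_def)
  show "{r\<in>\<sigma>. rel r \<le> st j} = phase ` {1..j}"
    using early late assms by (fastforce simp: \<sigma>_def)
  assume "\<tau> < st j"
  then show "{r\<in>\<sigma>. rel r \<le> \<tau>} \<subseteq> phase ` {1..<j}"
    using early(2) late by (fastforce simp: \<sigma>_def)
qed

lemma released_late:
  assumes "\<Theta> \<le> \<tau>"
  shows "{r\<in>\<sigma>. rel r \<le> \<tau>} = phase ` {1..n + 1} \<union> {left, right} \<union> (if T' \<le> \<tau> then {final} else {})"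
proof -
  have "rel (phase i) \<le> \<tau>" if "i \<le> n + 1" for i
    using power_le_1[OF that] theta_ge assms by (simp add: phase_def)
  then show ?thesis
    using assms delta theta_ge by (auto simp: \<sigma>_def left_def right_def final_def)
qed

lemma UN_bt:
  "j \<le> n + 2 \<Longrightarrow> (\<Union>i\<in>{1..<j}. bt i) = phase ` {1..<j}"
  "(\<Union>i\<in>{1..<n + 3}. bt i) = phase ` {1..n + 1} \<union> {left, right}"
proof -
  show *: "(\<Union>i\<in>{1..<j}. bt i) = phase ` {1..<j}" if "j \<le> n + 2" for j
    using that by (auto simp: bt_def)
  have "{1..<n + 3} = insert (n + 2) {1..<n + 2}" by auto
  then have "(\<Union>i\<in>{1..<n + 3}. bt i) = bt (n + 2) \<union> (\<Union>i\<in>{1..<n + 2}. bt i)"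
    by (simp only: UN_insert)
  moreover have "{1..<n + 2} = {1..n + 1}" "bt (n + 2) = {left, right}"
    by (auto simp: bt_def)
  ultimately show "(\<Union>i\<in>{1..<n + 3}. bt i) = phase ` {1..n + 1} \<union> {left, right}"
    using *[OF order_refl] by (simp only: Un_commute)
qed

text \<open>The pending set is constant on this interval, so the tour length does not change while
  the server waits for \<open>T\<close>.\<close>

lemma pending_pair:
  assumes "\<Theta> \<le> \<tau>" "\<tau> < T'"
  shows "{r\<in>\<sigma>. rel r \<le> \<tau>} - (\<Union>i\<in>{1..<n + 2}. bt i) = {left, right}"
proof -
  have "{r\<in>\<sigma>. rel r \<le> \<tau>} = phase ` {1..n + 1} \<union> {left, right}"
    unfolding released_late[OF assms(1)] using assms(2) by simp
  moreover have "(\<Union>i\<in>{1..<n + 2}. bt i) = phase ` {1..n + 1}"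
    unfolding UN_bt(1)[OF order_refl] by (rule arg_cong[of _ _ "image phase"]) auto
  moreover have "(A \<union> {left, right}) - A = {left, right}" if "A \<inter> {left, right, final} = {}" for A
    using that by blast
  note this[OF phase_disjoint]
  ultimately show ?thesis
    by (simp only:)
qed

section \<open>Lengths and end positions of the schedules\<close>

lemma schedule_phase:
  assumes "j \<in> {1..n + 1}"
  shows "\<exists>S. shortest_schedule c (st j) (lc j) (bt j) S"
    and "shortest_length c (st j) (lc j) (bt j) = fin j - st j"
    and "shortest_schedule c (st j) (lc j) (bt j) S \<Longrightarrow> traj S (fin j) = lc (Suc j)"
proof -
  have r: "rel (phase j) \<le> st j" "src (phase j) = dst (phase j)"
    using assms by (auto simp: phase_def st_def)
  obtain i where i: "j = Suc i" using assms by (cases j) auto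
  have "0 \<le> \<delta> * \<Theta> ^ i * (\<Theta> - 1)"
    using theta_ge delta by (intro mult_nonneg_nonneg) auto
  then have len: "\<bar>dst (phase j) - lc j\<bar> = fin j - st j"
    using assms i by (simp add: phase_def lc_def fin_def st_def algebra_simps)
  note single = shortest_schedule_singleton[OF c r, of "lc j", unfolded len]
  have bt: "bt j = {phase j}" using assms by (simp add: bt_def)
  show "\<exists>S. shortest_schedule c (st j) (lc j) (bt j) S"
    "shortest_length c (st j) (lc j) (bt j) = fin j - st j"
    unfolding bt by (rule single)+
  assume "shortest_schedule c (st j) (lc j) (bt j) S"
  then show "traj S (fin j) = lc (Suc j)"
    using single(3)[of S] assms by (simp add: bt phase_def lc_def)
qed

text \<open>The start time stays arbitrary because the length is needed at \<open>T\<close> and also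
  throughout the wait before it.\<close>

lemma schedule_pair:
  assumes "\<Theta> \<le> \<tau>"
  shows "\<exists>S. shortest_schedule c \<tau> (lc (n + 2)) {left, right} S"
    and "shortest_length c \<tau> (lc (n + 2)) {left, right} = (\<Theta> - 1) * T"
    and "shortest_schedule c \<tau> (lc (n + 2)) {left, right} S \<Longrightarrow>
      traj S (\<tau> + (\<Theta> - 1) * T) = - 1 - \<delta>"
proof -
  have lc: "lc (n + 2) = \<Theta> - \<delta>"
    using delta_power by (simp add: lc_def algebra_simps)
  have pair: "rel left \<le> \<tau>" "rel right \<le> \<tau>" "src left = dst left" "src right = dst right"
    "dst left \<le> lc (n + 2)" "lc (n + 2) \<le> dst right"
    "dst right - lc (n + 2) < lc (n + 2) - dst left"
    unfolding lc using assms delta theta_ge by (auto simp: left_def right_def)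
  have "2 * dst right - lc (n + 2) - dst left = (\<Theta> - 1) * T"
    unfolding lc T_mult by (simp add: left_def right_def)
  note * = shortest_schedule_pair[OF c pair, unfolded this]
  show "\<exists>S. shortest_schedule c \<tau> (lc (n + 2)) {left, right} S"
    "shortest_length c \<tau> (lc (n + 2)) {left, right} = (\<Theta> - 1) * T"
    by (rule *)+
  show "traj S (\<tau> + (\<Theta> - 1) * T) = - 1 - \<delta>"
    if "shortest_schedule c \<tau> (lc (n + 2)) {left, right} S"
    using *(3)[OF that] by (simp add: left_def)
qed

lemma schedule_final:
  shows "\<exists>S. shortest_schedule c (\<Theta> * T) (- 1 - \<delta>) {final} S"
    and "shortest_length c (\<Theta> * T) (- 1 - \<delta>) {final} = T' - (1 + \<delta>)"
proof -
  have "rel final \<le> \<Theta> * T" "src final = dst final"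
    using T'_le by (auto simp: final_def)
  note single = shortest_schedule_singleton[OF c this, of "- 1 - \<delta>"]
  show "\<exists>S. shortest_schedule c (\<Theta> * T) (- 1 - \<delta>) {final} S"
    by (rule single)
  have "\<bar>dst final - (- 1 - \<delta>)\<bar> = T' - (1 + \<delta>)"
    using right_le_final theta_ge delta by (simp add: final_def)
  with single(2) show "shortest_length c (\<Theta> * T) (- 1 - \<delta>) {final} = T' - (1 + \<delta>)"
    by simp
qed

lemma index_cases:
  assumes "j \<in> {1..n + 3}"
  obtains "j \<in> {1..n + 1}" | "j = n + 2" | "j = n + 3"
  using assms by fastforce

text \<open>Each chain schedule ends when the next request of the chain appears. The last equation
  later gives the immediate start of the final schedule.\<close>

lemma idle_eq: "j \<in> {2..n + 1} \<Longrightarrow> fin (j - 1) = st j" "fin (n + 1) = \<Theta>" "fin (n + 2) = \<Theta> * T"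
proof -
  show "fin (n + 1) = \<Theta>" "fin (n + 2) = \<Theta> * T"
    using delta_power by (auto simp: fin_def st_def)
  assume "j \<in> {2..n + 1}"
  then obtain i where "j = Suc (Suc i)"
    by (metis Suc_le_D atLeastAtMost_iff numeral_2_eq_2 Suc_le_mono)
  with \<open>j \<in> {2..n + 1}\<close> show "fin (j - 1) = st j"
    by (auto simp: fin_def st_def)
qed

section \<open>Verification of the script\<close>

lemma finite_sigma: "finite \<sigma>"
  by (simp add: \<sigma>_def)

lemma UN_bt_all: "(\<Union>j\<in>{1..n + 3}. bt j) = \<sigma>"
proof -
  have "{1..n + 3} = insert (n + 3) {1..<n + 3}" by auto
  then have "(\<Union>j\<in>{1..n + 3}. bt j) = bt (n + 3) \<union> (phase ` {1..n + 1} \<union> {left, right})"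
    by (simp only: UN_insert UN_bt(2))
  then show ?thesis
    by (auto simp: bt_def \<sigma>_def)
qed

lemma T_pos: "0 < T"
  using le_T(1) delta(1) by linarith

lemma st_nonneg: "0 \<le> st j"
  using delta(1) theta_ge T_pos by (simp add: st_def)

lemma idle_le_st:
  assumes "j \<in> {1..n + 3}"
  shows "(if j = 1 then 0 else fin (j - 1)) \<le> st j"
  using assms
proof (cases j rule: index_cases)
  case 1
  show ?thesis
  proof (cases "j = 1")
    case True
    then show ?thesis using st_nonneg by simp
  next
    case False
    with 1 have "j \<in> {2..n + 1}" by auto
    from idle_eq(1)[OF this] False show ?thesis by simp
  qed
next
  case 2
  then have "fin (j - 1) = \<Theta>" "st j = T" using idle_eq(2) by (simp_all add: st_def)
  then show ?thesis using 2 le_T(2) by simp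
next
  case 3
  then have "fin (j - 1) = \<Theta> * T" "st j = \<Theta> * T" using idle_eq(3) by (simp_all add: st_def)
  then show ?thesis using 3 by simp
qed

lemma st_le_fin:
  assumes "j \<in> {1..n + 3}"
  shows "st j \<le> fin j"
proof (cases "j = n + 3")
  case True
  have "1 + \<delta> \<le> T'" using T'_gt by simp
  then show ?thesis using True by (simp add: st_def fin_def)
next
  case False
  with assms have "fin j = \<Theta> * st j" by (simp add: fin_def)
  then show ?thesis
    using mult_right_mono[of 1 \<Theta> "st j"] theta_ge st_nonneg by simp
qed

lemma fin_le_st:
  assumes "j \<in> {1..n + 3}"
  shows "fin j \<le> \<Theta> * st j"
proof (cases "j = n + 3")
  case True
  then show ?thesis using T'_le(3) by (simp add: st_def fin_def)
next
  case False
  with assms show ?thesis by (simp add: fin_def)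
qed

lemma pending_st:
  assumes "j \<in> {1..n + 3}"
  shows "{r\<in>\<sigma>. rel r \<le> st j} - (\<Union>i\<in>{1..<j}. bt i) = bt j"
  using assms
proof (cases j rule: index_cases)
  case 1
  then have "{1..j} = insert j {1..<j}" "j \<le> n + 2" by auto
  moreover have "phase j \<notin> phase ` {1..<j}" using phase_eq_iff by auto
  moreover have "bt j = {phase j}" using 1 by (simp add: bt_def)
  ultimately show ?thesis
    unfolding released_phase(1)[OF 1] UN_bt(1)[OF \<open>j \<le> n + 2\<close>] by auto
next
  case 2
  then have "st j = T" "bt j = {left, right}" by (simp_all add: st_def bt_def)
  then show ?thesis
    unfolding 2 using pending_pair[OF le_T(2) T'_le(1)] by simp
next
  case 3
  then have eqs: "st j = \<Theta> * T" "bt j = {final}" by (simp_all add: st_def bt_def)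
  have "\<Theta> \<le> \<Theta> * T" using T'_le(1,2) le_T(2) by linarith
  then have released: "{r\<in>\<sigma>. rel r \<le> \<Theta> * T} = phase ` {1..n + 1} \<union> {left, right} \<union> {final}"
    using T'_le(2) by (simp only: released_late if_True)
  have served: "(\<Union>i\<in>{1..<j}. bt i) = phase ` {1..n + 1} \<union> {left, right}"
    using 3 UN_bt(2) by (simp only:)
  have "A \<union> {left, right} \<union> {final} - (A \<union> {left, right}) = {final}"
    if "A \<inter> {left, right, final} = {}" for A
    using that final_neq by auto
  then show ?thesis
    unfolding served eqs released using phase_disjoint by (simp only:)
qed

lemma schedule:
  assumes "j \<in> {1..n + 3}"
  shows "\<exists>S. shortest_schedule c (st j) (lc j) (bt j) S"
    and "shortest_length c (st j) (lc j) (bt j) = fin j - st j"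
    and "j \<noteq> n + 3 \<Longrightarrow> shortest_schedule c (st j) (lc j) (bt j) S \<Longrightarrow> traj S (fin j) = lc (Suc j)"
proof -
  have "(\<exists>S. shortest_schedule c (st j) (lc j) (bt j) S) \<and>
    shortest_length c (st j) (lc j) (bt j) = fin j - st j \<and>
    (j \<noteq> n + 3 \<longrightarrow> shortest_schedule c (st j) (lc j) (bt j) S \<longrightarrow> traj S (fin j) = lc (Suc j))"
    using assms
  proof (cases j rule: index_cases)
    case 1
    then show ?thesis using schedule_phase[OF 1] by blast
  next
    case 2
    then have eqs: "st j = T" "bt j = {left, right}" "fin j = T + (\<Theta> - 1) * T" "lc (Suc j) = - 1 - \<delta>"
      by (simp_all add: st_def bt_def fin_def lc_def algebra_simps)
    show ?thesis
      unfolding eqs unfolding 2 using schedule_pair[OF le_T(2)] by auto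
  next
    case 3
    then have eqs: "st j = \<Theta> * T" "bt j = {final}" "lc j = - 1 - \<delta>"
      "fin j = \<Theta> * T + (T' - (1 + \<delta>))"
      by (simp_all add: st_def bt_def fin_def lc_def)
    show ?thesis
      unfolding eqs using schedule_final 3 by simp
  qed
  then show "\<exists>S. shortest_schedule c (st j) (lc j) (bt j) S"
    "shortest_length c (st j) (lc j) (bt j) = fin j - st j"
    "j \<noteq> n + 3 \<Longrightarrow> shortest_schedule c (st j) (lc j) (bt j) S \<Longrightarrow> traj S (fin j) = lc (Suc j)"
    by blast+
qed

text \<open>In the chain nothing is pending before \<open>st j\<close>. For the pair the constant
  length \<open>(\<Theta> - 1) * T\<close> exceeds \<open>(\<Theta> - 1) * \<tau>\<close>. The last
  schedule has no waiting interval at all.\<close>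

lemma waits:
  assumes "j \<in> {1..n + 3}" "(if j = 1 then 0 else fin (j - 1)) \<le> \<tau>" "\<tau> < st j"
    and ne: "{r\<in>\<sigma>. rel r \<le> \<tau>} - (\<Union>i\<in>{1..<j}. bt i) \<noteq> {}"
  shows "(\<Theta> - 1) * \<tau> < shortest_length c \<tau> (lc j) ({r\<in>\<sigma>. rel r \<le> \<tau>} - (\<Union>i\<in>{1..<j}. bt i))"
  using assms(1)
proof (cases j rule: index_cases)
  case 1
  then have "j \<le> n + 2" by simp
  then show ?thesis
    using ne released_phase(2)[OF 1 assms(3)] unfolding UN_bt(1)[OF \<open>j \<le> n + 2\<close>] by blast
next
  case 2
  have "\<Theta> \<le> \<tau>" "\<tau> < T"
    using assms(2,3) 2 idle_eq(2) by (simp_all add: st_def)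
  then show ?thesis
    unfolding 2 using pending_pair[of \<tau>] T'_le(1) schedule_pair(2)[of \<tau>] theta_ge by simp
next
  case 3
  then have "fin (j - 1) = \<Theta> * T" "st j = \<Theta> * T" using idle_eq(3) by (simp_all add: st_def)
  then show ?thesis using assms(2,3) 3 by simp
qed

sublocale script: smartstart_script c \<Theta> \<sigma> "n + 3" st lc fin bt
proof (rule smartstart_script.intro)
  show "1 < \<Theta>" "1 \<le> n + 3" "lc 1 = 0"
    using theta_ge by (simp_all add: lc_def)
  show "finite \<sigma>"
    by (rule finite_sigma)
  show "(\<Union>j\<in>{1..n + 3}. bt j) = \<sigma>"
    by (rule UN_bt_all)
  show "bt j \<noteq> {}" for j
    by (simp add: bt_def)
  fix j
  show "traj S (fin j) = lc (Suc j)"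
    if "j \<in> {1..<n + 3}" "shortest_schedule c (st j) (lc j) (bt j) S" for S
    using schedule(3)[of j S] that by simp
  assume j: "j \<in> {1..n + 3}"
  show "{r\<in>\<sigma>. rel r \<le> st j} - (\<Union>i\<in>{1..<j}. bt i) = bt j"
    by (rule pending_st[OF j])
  show "(if j = 1 then 0 else fin (j - 1)) \<le> st j"
    by (rule idle_le_st[OF j])
  show "st j \<le> fin j"
    by (rule st_le_fin[OF j])
  show "shortest_length c (st j) (lc j) (bt j) = fin j - st j"
    by (rule schedule(2)[OF j])
  show "fin j \<le> \<Theta> * st j"
    by (rule fin_le_st[OF j])
  show "\<exists>S. shortest_schedule c (st j) (lc j) (bt j) S"
    by (rule schedule(1)[OF j])
  show "(\<Theta> - 1) * \<tau> < shortest_length c \<tau> (lc j) ({r\<in>\<sigma>. rel r \<le> \<tau>} - (\<Union>i\<in>{1..<j}. bt i))"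
    if "(if j = 1 then 0 else fin (j - 1)) \<le> \<tau>" "\<tau> < st j"
      "{r\<in>\<sigma>. rel r \<le> \<tau>} - (\<Union>i\<in>{1..<j}. bt i) \<noteq> {}" for \<tau>
    by (rule waits[OF j that])
qed

text \<open>The optimum moves to \<open>left\<close>, reaching it at its release time, and then sweeps to the right.\<close>

lemma Opt_eq: "Opt c \<sigma> = T'"
proof -
  define x where "x = 1 + \<delta>"
  \<comment> \<open>Leftwards to \<open>- x\<close> at time \<open>x\<close>, then rightwards: a
    position \<open>a \<ge> - x\<close> is passed at time \<open>a + 2 * x\<close>, which explains
    \<open>d\<close>.\<close>
  define f where "f \<tau> = \<bar>\<tau> - x\<bar> - x" for \<tau>
  define d where "d r = src r + 2 * x" for r
  define S\<^sub>0 where "S\<^sub>0 = \<lparr>traj = f, pickup = d, delivery = d\<rparr>"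
  have r: "- x \<le> src r \<and> src r \<le> T' - 2 * x \<and> rel r \<le> src r + 2 * x \<and> src r = dst r"
    if "r \<in> \<sigma>" for r
  proof -
    have "0 \<le> src (phase j)" "src (phase j) \<le> T' - 2 * x" "rel (phase j) \<le> 1 + \<delta>" if "j \<le> n + 1" for j
    proof -
      show "rel (phase j) \<le> 1 + \<delta>" using power_le_1[OF that] delta(1) by (simp add: phase_def)
      show "0 \<le> src (phase j)" using theta_ge delta by (simp add: phase_def)
      have "\<delta> * \<Theta> ^ j \<le> \<delta> * \<Theta> ^ (n + 1)"
        using that theta_ge delta by (intro mult_left_mono power_increasing) auto
      also have "\<dots> = \<Theta>" using delta_power by (simp add: algebra_simps)
      finally show "src (phase j) \<le> T' - 2 * x"
        using right_le_final theta_ge delta by (simp add: phase_def x_def)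
    qed
    moreover have "src (phase j) = dst (phase j)" for j
      by (simp add: phase_def)
    ultimately have phase: "?thesis" if "r = phase j" "j \<le> n + 1" for j
      using that delta(1) by (fastforce simp: x_def)
    have other: "?thesis" if "r \<in> {left, right, final}"
      using that right_le_final theta_ge delta by (auto simp: x_def left_def right_def final_def)
    from \<open>r \<in> \<sigma>\<close> consider j where "r = phase j" "j \<le> n + 1" | "r \<in> {left, right, final}"
      by (auto simp: \<sigma>_def)
    then show ?thesis
      by cases (fact phase, fact other)
  qed
  have "1-lipschitz_on {0..} f"
    by (rule lipschitz_onI) (auto simp: f_def dist_real_def)
  then have feas: "feasible_schedule c 0 0 \<sigma> S\<^sub>0"
    unfolding S\<^sub>0_def using c r delta
    by (intro feasible_point_schedule) (force simp: f_def d_def x_def)+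
  have T': "0 \<le> T'" using T'_le le_T delta by linarith
  have len: "schedule_length 0 \<sigma> S\<^sub>0 \<le> T'"
    using r by (intro schedule_length_le finite_sigma T') (force simp: S\<^sub>0_def d_def)
  \<comment> \<open>No schedule can deliver \<open>final\<close> before its release.\<close>
  have low: "T' \<le> schedule_length 0 \<sigma> S" if "feasible_schedule c 0 0 \<sigma> S" for S
  proof -
    have "final \<in> \<sigma>" by (simp add: \<sigma>_def)
    then show ?thesis
      using feasible_schedule_delivery(2)[OF that] delivery_le_schedule_length[OF finite_sigma, of final S 0]
      by (fastforce simp: final_def)
  qed
  show ?thesis
    unfolding Opt_def by (rule shortest_scheduleI(2)[OF feas len low])
qed

lemma instance_sigma: "dial_a_ride_instance \<sigma>"
proof -
  have "0 \<le> T'" using T'_le le_T delta by linarith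
  then show ?thesis
    using delta theta_ge finite_sigma
    by (auto simp: dial_a_ride_instance_def \<sigma>_def left_def right_def final_def phase_def)
qed

text \<open>Substituting \<open>T = T' - 4 * \<delta>\<close> gives the cost
  \<open>(\<Theta> + 1) * T' - 1 - (4 * \<Theta> + 1) * \<delta>\<close>. Division by
  \<open>T'\<close> leaves the loss \<open>1 / T'\<close> and an error that vanishes with
  \<delta>.\<close>

lemma ratio_ge:
  "\<Theta> + 1 - (\<Theta> - 1) / (3 * \<Theta> + 3) - (4 * \<Theta> + 1) * \<delta> \<le> fin (n + 3) / Opt c \<sigma>"
proof -
  have T': "1 \<le> T'" using T'_le le_T theta_ge by linarith
  \<comment> \<open>By \<open>2 \<le> \<Theta>\<close>, the margin in \<open>T'\<close> outweighs
    the \<open>2 * \<delta>\<close> missing in \<open>T\<close>.\<close>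
  have "\<delta> * 1 \<le> \<delta> * (\<Theta> - 1)" using delta theta_ge by (intro mult_left_mono) auto
  then have "3 * \<Theta> + 3 \<le> (\<Theta> - 1) * T'"
    using delta by (simp add: T'_def T_mult distrib_left)
  then have "1 / T' \<le> (\<Theta> - 1) / (3 * \<Theta> + 3)"
    using T' theta_ge by (simp add: field_simps)
  moreover have "(4 * \<Theta> + 1) * \<delta> / T' \<le> (4 * \<Theta> + 1) * \<delta>"
    using T' theta_ge delta by (simp add: divide_le_eq mult_left_le)
  moreover have "fin (n + 3) = (\<Theta> + 1) * T' - 1 - (4 * \<Theta> + 1) * \<delta>"
    by (simp add: fin_def T'_def algebra_simps)
  then have "fin (n + 3) / Opt c \<sigma> = \<Theta> + 1 - 1 / T' - (4 * \<Theta> + 1) * \<delta> / T'"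
    unfolding Opt_eq using T' by (simp only: diff_divide_distrib) simp
  ultimately show ?thesis by linarith
qed

end

theorem proposition4p3:
  fixes c :: enat and \<Theta> :: real
  assumes "c \<ge> 1" and "2 \<le> \<Theta>" and "\<Theta> \<le> 1 / 2 * (1 + sqrt 13)"
  shows "\<exists>\<epsilon>0>0. \<forall>\<epsilon>::real. 0 < \<epsilon> \<and> \<epsilon> < \<epsilon>0 \<longrightarrow>
    (\<exists>\<sigma>. dial_a_ride_instance \<sigma> \<and>
       (\<exists>\<rho>. smartstart_run c \<Theta> \<sigma> \<rho>) \<and>
       (\<forall>\<rho>. smartstart_run c \<Theta> \<sigma> \<rho> \<longrightarrow>
          final_starts_immediately c \<rho> \<and>
          smartstart_cost c \<rho> / Opt c \<sigma>
            \<ge> \<Theta> + 1 - (\<Theta> - 1) / (3 * \<Theta> + 3) - \<epsilon>))"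
proof (intro exI[of _ "1 :: real"] conjI allI impI)
  fix \<epsilon> :: real
  assume \<epsilon>: "0 < \<epsilon> \<and> \<epsilon> < 1"
  \<comment> \<open>The bound on \<Theta> says \<open>2 * \<Theta> - 1 \<le> sqrt 13\<close>, with a
    nonnegative left side.\<close>
  have "(2 * \<Theta> - 1)\<^sup>2 \<le> (sqrt 13)\<^sup>2"
    using assms by (intro power_mono) auto
  then have square: "\<Theta>\<^sup>2 \<le> \<Theta> + 3"
    by (simp add: power2_eq_square algebra_simps)
  \<comment> \<open>A chain long enough to push the error
    \<open>(4 * \<Theta> + 1) * \<delta>\<close> below \<epsilon>.\<close>
  obtain n where n: "(4 * \<Theta> + 1) / \<epsilon> < \<Theta> ^ n"
    using real_arch_pow[of \<Theta> "(4 * \<Theta> + 1) / \<epsilon>"] assms by auto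
  interpret lower_bound c \<Theta> n
    using assms square by unfold_locales
  have "(4 * \<Theta> + 1) * \<delta> \<le> \<epsilon>"
    using n \<epsilon> assms by (simp add: \<delta>_def field_simps)
  then have ratio: "\<Theta> + 1 - (\<Theta> - 1) / (3 * \<Theta> + 3) - \<epsilon> \<le> fin (n + 3) / Opt c \<sigma>"
    using ratio_ge by linarith
  have "final_starts_immediately c \<rho>" if "smartstart_run c \<Theta> \<sigma> \<rho>" for \<rho>
    using script.run_final_starts_immediately[OF that] idle_eq(3) by (simp add: st_def)
  then show "\<exists>\<sigma>. dial_a_ride_instance \<sigma> \<and> (\<exists>\<rho>. smartstart_run c \<Theta> \<sigma> \<rho>) \<and>
      (\<forall>\<rho>. smartstart_run c \<Theta> \<sigma> \<rho> \<longrightarrow> final_starts_immediately c \<rho> \<and>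
        smartstart_cost c \<rho> / Opt c \<sigma> \<ge> \<Theta> + 1 - (\<Theta> - 1) / (3 * \<Theta> + 3) - \<epsilon>)"
    using instance_sigma script.run_exists script.run_cost ratio by (intro exI[of _ \<sigma>]) simp
qed simp

end
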